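(* Let $n, K, L$ be positive integers, let $N = 2n-1$, and assume $K < n$. Let $S_0^L, S_{\mathrm{HT}}^L, S_{\mathrm{MF}}^L \subseteq \mathbb{C}^{N\times L}$ be, respectively, the set of general multichannel spectrally sparse signals, the set defined by rank-constrained positive semidefinite Hankel-Toeplitz matrices, and the set defined by Hankel-Toeplitz matrix factorization (all three are defined in the context). Then $S_{\mathrm{MF}}^L = S_{\mathrm{HT}}^L = S_0^L$.
   Context: Notation: $N = 2n-1$. For a matrix $X$, $X_{:,l}$ is its $l$-th column, $\overline{X}$ its entrywise complex conjugate, $X^T$ its transpose and $X^H$ its conjugate transpose; $\overline{X}_{:,l}$ is the $l$-th column of $\overline{X}$. $\mathbb{S}_K^+$ denotes the set of (Hermitian) positive semidefinite matrices of rank at most $K$ (here of size $2n\times 2n$). Hankel operator: for $x\in\mathbb{C}^N$, $\mathcal{H}x\in\mathbb{C}^{n\times n}$ is the Hankel matrix with entries $(\mathcal{H}x)_{jk} = x_{j+k-1}$, $1\le j,k\le n$. Toeplitz operator: for $t\in\mathbb{C}^N$, $\mathcal{T}t\in\mathbb{C}^{n\times n}$ is the Toeplitz matrix with entries $(\mathcal{T}t)_{jk} = t_{n+j-k}$, $1\le j,k\le n$. For $f\in[0,1)$, let $a(f)\in\mathbb{C}^N$ have entries $[a(f)]_j = e^{-i2\pi f(j-1)}$, $j=1,\dots,N$, and for $f=(f_1,\dots,f_K)\in[0,1)^K$ let $A(f) = [a(f_1),\dots,a(f_K)]\in\mathbb{C}^{N\times K}$. The sets are: (1) $S_0^L = \{A(f)S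 : f_k\in[0,1) \text{ for } k=1,\dots,K,\ S\in\mathbb{C}^{K\times L}\}$. (2) $S_{\mathrm{HT}}^L$ is the set of $X\in\mathbb{C}^{N\times L}$ for which there exist $t^1,\dots,t^L\in\mathbb{C}^N$ and $t\in\mathbb{C}^N$ with $\sum_{l=1}^L t^l = L t$ such that for every $l=1,\dots,L$, $$\begin{bmatrix}\mathcal{T}\overline{t^l} & \mathcal{H}\overline{X}_{:,l}\\ \mathcal{H}X_{:,l} & \mathcal{T}t\end{bmatrix}\in\mathbb{S}_K^+.$$ (3) $S_{\mathrm{MF}}^L$ is the set of $X\in\mathbb{C}^{N\times L}$ for which there exist $t^1,\dots,t^L\in\mathbb{C}^N$ and matrices $Z_1^l, Z_2^l\in\mathbb{C}^{n\times K}$, $l=1,\dots,L$, such that for every $l=1,\dots,L$, $$\mathcal{H}X_{:,l} = Z_2^l (Z_1^l)^H,\qquad \mathcal{T}\overline{t^l} = Z_1^l (Z_1^l)^H,\qquad \frac1L\sum_{q=1}^L\mathcal{T}t^q = Z_2^l (Z_2^l)^H.$$ *)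

theory Defs
  imports
    Complex_Main
    "Jordan_Normal_Form.Schur_Decomposition"
    "Jordan_Normal_Form.DL_Rank"
begin

(* Vectors and matrices are indexed from 0, so the one-based x_{j+k-1} becomes x $ (j + k). *)

definition hankel :: "nat \<Rightarrow> complex vec \<Rightarrow> complex mat" where
  "hankel n x = mat n n (\<lambda>(j, k). x $ (j + k))"

(* The one-based entry t_{n+j-k} is t $ (n + j - k - 1); for j, k < n the natural-number
   subtraction does not truncate. *)

definition toeplitz :: "nat \<Rightarrow> complex vec \<Rightarrow> complex mat" where
  "toeplitz n t = mat n n (\<lambda>(j, k). t $ (n + j - k - 1))"

definition sinusoid :: "nat \<Rightarrow> real \<Rightarrow> complex vec" where
  "sinusoid N f = vec N (\<lambda>j. exp (- (\<i> * complex_of_real (2 * pi * f * real j))))"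

definition sinusoid_mat :: "nat \<Rightarrow> nat \<Rightarrow> (nat \<Rightarrow> real) \<Rightarrow> complex mat" where
  "sinusoid_mat N K f = mat_of_cols N (map (\<lambda>k. sinusoid N (f k)) [0..<K])"

(* The order on complex is that of Complex_Order: 0 \<le> z says that z is real and nonnegative. *)

definition psd_mats_rank_le :: "nat \<Rightarrow> nat \<Rightarrow> complex mat set" where
  "psd_mats_rank_le m K =
     {M \<in> carrier_mat m m.
        mat_adjoint M = M \<and>
        (\<forall>v \<in> carrier_vec m. 0 \<le> (M *\<^sub>v v) \<bullet>c v) \<and>
        vec_space.rank m M \<le> K}"

definition S_0 :: "nat \<Rightarrow> nat \<Rightarrow> nat \<Rightarrow> complex mat set" where
  "S_0 n K L =
     {sinusoid_mat (2 * n - 1) K f * S | f S.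
        (\<forall>k<K. f k \<in> {0..<1}) \<and> S \<in> carrier_mat K L}"

definition S_HT :: "nat \<Rightarrow> nat \<Rightarrow> nat \<Rightarrow> complex mat set" where
  "S_HT n K L =
     {X \<in> carrier_mat (2 * n - 1) L.
        \<exists>(ts :: nat \<Rightarrow> complex vec) (t :: complex vec).
          (\<forall>l<L. ts l \<in> carrier_vec (2 * n - 1)) \<and> t \<in> carrier_vec (2 * n - 1) \<and>
          finsum_vec TYPE(complex) (2 * n - 1) ts {..<L} = of_nat L \<cdot>\<^sub>v t \<and>
          (\<forall>l<L.
             four_block_mat
               (toeplitz n (conjugate (ts l))) (hankel n (col (map_mat cnj X) l))
               (hankel n (col X l))            (toeplitz n t)
             \<in> psd_mats_rank_le (2 * n) K)}"

(* The sum over q of the Toeplitz matrices is written entrywise. *)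

definition S_MF :: "nat \<Rightarrow> nat \<Rightarrow> nat \<Rightarrow> complex mat set" where
  "S_MF n K L =
     {X \<in> carrier_mat (2 * n - 1) L.
        \<exists>(ts :: nat \<Rightarrow> complex vec) (Z1 :: nat \<Rightarrow> complex mat) (Z2 :: nat \<Rightarrow> complex mat).
          (\<forall>l<L. ts l \<in> carrier_vec (2 * n - 1) \<and>
                 Z1 l \<in> carrier_mat n K \<and> Z2 l \<in> carrier_mat n K) \<and>
          (\<forall>l<L.
             hankel n (col X l) = Z2 l * mat_adjoint (Z1 l) \<and>
             toeplitz n (conjugate (ts l)) = Z1 l * mat_adjoint (Z1 l) \<and>
             (1 / of_nat L) \<cdot>\<^sub>m mat n n (\<lambda>(j, k). \<Sum>q<L. toeplitz n (ts q) $$ (j, k)) =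
               Z2 l * mat_adjoint (Z2 l))}"

end

theory Submission
  imports Defs "HOL-Computational_Algebra.Fundamental_Theorem_Algebra"
begin

text \<open>The inclusions are proved in the cycle \<open>S_0 \<subseteq> S_MF \<subseteq> S_HT \<subseteq> S_0\<close>. The first splits the amplitudes of
  the sinusoids between the two factors, and the second holds because the block matrix is \<open>Z Z\<^sup>H\<close> with
  \<open>Z\<close> the stack of \<open>Z1\<close> and \<open>Z2\<close>.

  For the third, the Vandermonde decomposition of \<open>T = toeplitz n t\<close> is replaced by its annihilating
  polynomial. As \<open>rank T \<le> K < n\<close>, some nonzero polynomial of degree at most \<open>K\<close> is isotropic for the
  form \<open>T\<close>; let \<open>g\<close> be one of least degree. Shift invariance of the form makes the roots of \<open>g\<close>
  simple and unimodular. A null vector of a positive semidefinite matrix lies in its kernel, so the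
  shifts of \<open>g\<close>, padded with zeros, are killed by every block matrix. Hence each conjugated channel
  satisfies the linear recurrence of \<open>g\<close> and is a combination of powers of its roots, which do not
  depend on the channel.\<close>

subsection \<open>Linear recurrences and isotropic polynomials of Toeplitz forms\<close>

text \<open>Induction on the degree. With p = (z - a) q, the recurrence says that \<open>y\<close>,
  the result of applying q to the shifts of \<open>x\<close>, is geometric with ratio a. Subtracting
  a suitable multiple of a^i leaves a sequence that obeys the recurrence of q.\<close>

lemma linear_recurrence_simple_roots:
  fixes p :: "complex poly" and x :: "nat \<Rightarrow> complex"
  assumes "p \<noteq> 0" and "\<And>a. \<not> [:- a, 1:]\<^sup>2 dvd p"
    and "\<And>s. s + degree p < N \<Longrightarrow> (\<Sum>i\<le>degree p. coeff p i * x (i + s)) = 0"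
  shows "\<exists>c. \<forall>i<N. x i = (\<Sum>a | poly p a = 0. c a * a ^ i)"
  using assms
proof (induction "degree p" arbitrary: p x)
  case 0
  then obtain c where p: "p = [:c:]" "c \<noteq> 0"
    by (metis degree_eq_zeroE pCons_eq_0_iff)
  then have "x i = 0" if "i < N" for i
    using 0(4)[of i] that by simp
  then show ?case
    using p by simp
next
  case (Suc d)
  obtain a where a: "poly p a = 0"
    using fundamental_theorem_of_algebra[of p] Suc.hyps(2) constant_degree[of p] by auto
  then obtain q where p: "p = [:- a, 1:] * q"
    by (auto simp: poly_eq_0_iff_dvd)
  have q0: "q \<noteq> 0" using Suc.prems(1) p by auto
  have dq: "degree q = d"
    using Suc.hyps(2) degree_mult_eq[of "[:- a, 1:]" q] q0 unfolding p by simp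
  have qa: "poly q a \<noteq> 0"
    using Suc.prems(2)[of a] mult_dvd_mono[of "[:- a, 1:]" "[:- a, 1:]" "[:- a, 1:]" q]
    unfolding p poly_eq_0_iff_dvd power2_eq_square by (metis dvd_refl)
  have q_simple: "\<not> [:- b, 1:]\<^sup>2 dvd q" for b
    using Suc.prems(2)[of b] unfolding p using dvd_mult by blast
  define y where "y s = (\<Sum>i\<le>d. coeff q i * x (i + s))" for s
  have step: "(\<Sum>i\<le>Suc d. coeff p i * x (i + s)) = y (Suc s) - a * y s" for s
  proof -
    have "(\<Sum>i\<le>Suc d. coeff p i * x (i + s))
        = (\<Sum>i\<le>Suc d. coeff (pCons 0 q) i * x (i + s)) - a * (\<Sum>i\<le>Suc d. coeff q i * x (i + s))"
      unfolding p by (simp add: sum_subtractf sum_distrib_left algebra_simps sum.distrib sum_negf)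
    moreover have "(\<Sum>i\<le>Suc d. coeff (pCons 0 q) i * x (i + s)) = y (Suc s)"
      by (subst sum.atMost_Suc_shift) (simp add: y_def)
    moreover have "(\<Sum>i\<le>Suc d. coeff q i * x (i + s)) = y s"
      using coeff_eq_0[of q "Suc d"] dq by (simp add: y_def)
    ultimately show ?thesis by simp
  qed
  have y: "y s = y 0 * a ^ s" if "s + d < N" for s
    using that
  proof (induction s)
    case (Suc s)
    then show ?case
      using Suc.prems step[of s] \<open>\<And>s. s + degree p < N \<Longrightarrow> _\<close>[of s] \<open>Suc d = degree p\<close> by simp
  qed simp
  \<comment> \<open>Applying q to r a^i gives r q(a) a^s, which has to equal
    \<open>y 0 * a ^ s\<close>. The division is possible because a is a simple root.\<close>
  define r where "r = y 0 / poly q a"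
  define x' where "x' i = x i - r * a ^ i" for i
  have "(\<Sum>i\<le>degree q. coeff q i * x' (i + s)) = 0" if "s + degree q < N" for s
  proof -
    have "(\<Sum>i\<le>degree q. coeff q i * x' (i + s))
        = y s - r * a ^ s * (\<Sum>i\<le>degree q. coeff q i * a ^ i)"
      by (simp add: x'_def y_def dq algebra_simps sum_subtractf sum_distrib_left power_add)
    also have "\<dots> = 0"
      unfolding poly_altdef[symmetric] using y[of s] that qa dq by (simp add: r_def)
    finally show ?thesis .
  qed
  then obtain c where c: "\<And>i. i < N \<Longrightarrow> x' i = (\<Sum>b | poly q b = 0. c b * b ^ i)"
    using Suc.hyps(1)[of q x'] q0 q_simple dq by blast
  define c' where "c' = c(a := r)"
  have roots: "{b. poly p b = 0} = insert a {b. poly q b = 0}"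
    unfolding p by auto
  have "x i = (\<Sum>b | poly p b = 0. c' b * b ^ i)" if "i < N" for i
  proof -
    have "(\<Sum>b | poly q b = 0. c' b * b ^ i) = (\<Sum>b | poly q b = 0. c b * b ^ i)"
      using qa by (intro sum.cong) (auto simp: c'_def)
    then show ?thesis
      unfolding roots using c[OF that] qa poly_roots_finite[OF q0] by (simp add: x'_def c'_def diff_eq_eq add.commute)
  qed
  then show ?case by blast
qed

section \<open>Sesquilinear forms on polynomials\<close>

text \<open>Reading vectors as polynomials turns the shift into multiplication by z and lets roots
  be split off. Coefficients from index \<open>n\<close> on are ignored, hence the degree bounds
  below.\<close>

definition poly_form :: "nat \<Rightarrow> (nat \<Rightarrow> nat \<Rightarrow> complex) \<Rightarrow> complex poly \<Rightarrow> complex poly \<Rightarrow> complex" where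
  "poly_form n T p q = (\<Sum>j<n. \<Sum>k<n. cnj (coeff q j) * T j k * coeff p k)"

lemma poly_form_diff_left: "poly_form n T (p - p') q = poly_form n T p q - poly_form n T p' q"
  by (simp add: poly_form_def algebra_simps sum_subtractf)

lemma poly_form_smult_left: "poly_form n T (smult c p) q = c * poly_form n T p q"
  by (simp add: poly_form_def algebra_simps sum_distrib_left)

lemma poly_form_cnj:
  assumes "\<And>j k. j < n \<Longrightarrow> k < n \<Longrightarrow> T j k = cnj (T k j)"
  shows "poly_form n T q p = cnj (poly_form n T p q)"
proof -
  have "cnj (poly_form n T p q) = (\<Sum>j<n. \<Sum>k<n. coeff q j * cnj (T j k) * cnj (coeff p k))"
    by (simp add: poly_form_def)
  also have "\<dots> = (\<Sum>k<n. \<Sum>j<n. coeff q j * cnj (T j k) * cnj (coeff p k))"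
    by (rule sum.swap)
  also have "\<dots> = poly_form n T q p"
    unfolding poly_form_def by (intro sum.cong refl) (simp flip: assms)
  finally show ?thesis by simp
qed

text \<open>Constancy along diagonals makes multiplication by z an isometry. By the degree bounds
  coefficient \<open>n - 1\<close> vanishes, so the truncation at \<open>n\<close> loses
  nothing.\<close>

lemma poly_form_shift:
  assumes T: "\<And>j k. Suc j < n \<Longrightarrow> Suc k < n \<Longrightarrow> T (Suc j) (Suc k) = T j k"
    and deg: "Suc (degree p) < n" "Suc (degree q) < n"
  shows "poly_form n T (pCons 0 p) (pCons 0 q) = poly_form n T p q"
proof -
  obtain m where n: "n = Suc m" and p: "coeff p m = 0" and q: "coeff q m = 0"
    using deg by (cases n) (auto intro!: coeff_eq_0)
  have "poly_form n T (pCons 0 p) (pCons 0 q)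
      = (\<Sum>j<m. \<Sum>k<m. cnj (coeff q j) * T (Suc j) (Suc k) * coeff p k)"
    unfolding poly_form_def n sum.lessThan_Suc_shift by simp
  also have "\<dots> = (\<Sum>j<m. \<Sum>k<m. cnj (coeff q j) * T j k * coeff p k)"
    using T n by (intro sum.cong refl) auto
  also have "\<dots> = poly_form n T p q"
    using p q by (simp add: poly_form_def n)
  finally show ?thesis .
qed

text \<open>Write \<open>\<langle>p, q\<rangle>\<close> for \<open>poly_form n T p q\<close>. Multiplication by \<open>z\<close> preserves it, so
  \<open>g = (z - a) h\<close> gives \<open>\<bar>a\<bar>\<^sup>2 \<langle>h, h\<rangle> = \<langle>zh, zh\<rangle> = \<langle>h, h\<rangle>\<close>; if moreover \<open>h = (z - a) h'\<close>, a similar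
  computation gives \<open>\<langle>h, h\<rangle> = 0\<close>. Both times minimality of \<open>g\<close> applies.\<close>

lemma minimal_null_poly_roots:
  assumes toep: "\<And>j k. Suc j < n \<Longrightarrow> Suc k < n \<Longrightarrow> T (Suc j) (Suc k) = T j k"
    and herm: "\<And>j k. j < n \<Longrightarrow> k < n \<Longrightarrow> T j k = cnj (T k j)"
    and null: "\<And>q. poly_form n T g q = 0"
    and g: "g \<noteq> 0" "degree g < n"
    and minimal: "\<And>h. h \<noteq> 0 \<Longrightarrow> degree h < degree g \<Longrightarrow> poly_form n T h h \<noteq> 0"
  shows "poly g a = 0 \<Longrightarrow> cmod a = 1" and "\<not> [:- a, 1:]\<^sup>2 dvd g"
proof -
  let ?B = "poly_form n T"
  have cnj: "?B q p = cnj (?B p q)" for p q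
    by (rule poly_form_cnj) (rule herm)
  note shift = poly_form_shift[of n T, OF toep]
  \<comment> \<open>Since \<open>g\<close> pairs to zero with everything, multiplying
    \<open>h\<close> by z acts inside the form as the scalar a.\<close>
  have lin: "?B (pCons 0 h) q = a * ?B h q" if "g = [:- a, 1:] * h" for a h q
  proof -
    have "?B g q = ?B (pCons 0 h) q - a * ?B h q"
      unfolding that by (simp add: poly_form_diff_left poly_form_smult_left flip: diff_conv_add_uminus)
    then show ?thesis using null by simp
  qed
  have quotient: "h \<noteq> 0" "degree g = Suc (degree h)" if h: "g = [:- a, 1:] * h" for a h
  proof -
    show "h \<noteq> 0" using h g by auto
    then show "degree g = Suc (degree h)"
      unfolding h by (subst degree_mult_eq) auto
  qed
  have unit: "a * cnj a = 1" if "poly g a = 0" for a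
  proof -
    from that obtain h where h: "g = [:- a, 1:] * h"
      by (auto simp: poly_eq_0_iff_dvd)
    have "?B h h = ?B (pCons 0 h) (pCons 0 h)"
      using shift[of h h] quotient[OF h] g by simp
    also have "\<dots> = a * ?B h (pCons 0 h)"
      by (rule lin[OF h])
    also have "?B h (pCons 0 h) = cnj a * ?B h h"
      unfolding cnj[of h "pCons 0 h"] lin[OF h] by (simp flip: cnj)
    finally have "?B h h = a * cnj a * ?B h h" by simp
    moreover have "?B h h \<noteq> 0"
      using minimal quotient[OF h] by simp
    ultimately show ?thesis by simp
  qed
  then show "cmod a = 1" if "poly g a = 0"
    using unit[OF that] by (simp flip: complex_norm_square of_real_power add: power2_eq_1_iff) (use norm_ge_zero[of a] in linarith)
  show "\<not> [:- a, 1:]\<^sup>2 dvd g"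
  proof
    assume "[:- a, 1:]\<^sup>2 dvd g"
    then obtain h where "g = [:- a, 1:]\<^sup>2 * h" by auto
    define u where "u = [:- a, 1:] * h"
    have gu: "g = [:- a, 1:] * u"
      by (simp add: \<open>g = _\<close> u_def power2_eq_square mult.assoc del: mult_pCons_left)
    have u: "u = pCons 0 h - smult a h"
      by (simp add: u_def)
    have "h \<noteq> 0"
      using quotient(1)[OF gu] u_def by auto
    then have dh: "degree u = Suc (degree h)"
      unfolding u_def by (subst degree_mult_eq) auto
    \<comment> \<open>Here \<open>u\<close> and \<open>h\<close> are the h and h' of the text above.
      The chain leads to a <h, u> = <zh, u>, and u = zh - ah turns this into <u, u> = 0.\<close>
    have "?B h u = ?B (pCons 0 h) (pCons 0 u)"
      using shift[of h u] quotient[OF gu] g dh by simp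
    also have "\<dots> = cnj a * ?B (pCons 0 h) u"
      unfolding cnj[of "pCons 0 h" "pCons 0 u"] lin[OF gu] cnj[of "pCons 0 h" u]
      by (rule complex_cnj_mult)
    finally have "a * ?B h u = (a * cnj a) * ?B (pCons 0 h) u" by simp
    also have "a * cnj a = 1"
      using unit[of a] gu by simp
    finally have "?B u u = 0"
      by (subst (1) u) (simp add: poly_form_diff_left poly_form_smult_left)
    then show False
      using minimal[of u] quotient[OF gu] by simp
  qed
qed

subsection \<open>Positive semidefinite matrices and rank\<close>

lemma mat_adjoint_simps [simp]:
  "dim_row (mat_adjoint A) = dim_col A" "dim_col (mat_adjoint A) = dim_row A"
  "i < dim_col A \<Longrightarrow> j < dim_row A \<Longrightarrow> mat_adjoint A $$ (i, j) = conjugate (A $$ (j, i))"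
  by (auto simp: mat_adjoint_def mat_of_rows_index)

lemma index_mult_adjoint:
  fixes A B :: "complex mat"
  assumes "A \<in> carrier_mat m k" "B \<in> carrier_mat m' k" "i < m" "j < m'"
  shows "(A * mat_adjoint B) $$ (i, j) = (\<Sum>h<k. A $$ (i, h) * cnj (B $$ (j, h)))"
  using assms by (auto simp: scalar_prod_def atLeast0LessThan intro!: sum.cong)

lemma cscalar_prod_mat_adjoint:
  fixes A :: "complex mat"
  assumes A: "A \<in> carrier_mat m k" and v: "v \<in> carrier_vec k" and w: "w \<in> carrier_vec m"
  shows "(A *\<^sub>v v) \<bullet>c w = v \<bullet>c (mat_adjoint A *\<^sub>v w)"
proof -
  have "(A *\<^sub>v v) \<bullet>c w = (\<Sum>i<m. \<Sum>j<k. A $$ (i, j) * v $ j * cnj (w $ i))"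
    using A v w by (auto simp: scalar_prod_def atLeast0LessThan sum_distrib_right intro!: sum.cong)
  also have "\<dots> = (\<Sum>j<k. \<Sum>i<m. A $$ (i, j) * v $ j * cnj (w $ i))"
    by (rule sum.swap)
  also have "\<dots> = v \<bullet>c (mat_adjoint A *\<^sub>v w)"
    using A v w by (auto simp: scalar_prod_def atLeast0LessThan sum_distrib_left mult_ac intro!: sum.cong)
  finally show ?thesis .
qed

text \<open>Move from \<open>v\<close> against w = Mv: at v - e w the form equals e (e c - 2 a),
  where a = <w, w> and c = <Mw, w>. For small positive e this is negative unless a = 0.\<close>

lemma psd_null_vector:
  assumes M: "M \<in> psd_mats_rank_le m K" and v: "v \<in> carrier_vec m" and null: "(M *\<^sub>v v) \<bullet>c v = 0"
  shows "M *\<^sub>v v = 0\<^sub>v m"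
proof -
  define w where "w = M *\<^sub>v v"
  have Mc: "M \<in> carrier_mat m m" and adj: "mat_adjoint M = M"
    and psd: "\<And>u. u \<in> carrier_vec m \<Longrightarrow> 0 \<le> (M *\<^sub>v u) \<bullet>c u"
    using M by (auto simp: psd_mats_rank_le_def)
  have w: "w \<in> carrier_vec m" and Mw: "M *\<^sub>v w \<in> carrier_vec m"
    using Mc v by (auto simp: w_def)
  obtain a where a: "w \<bullet>c w = complex_of_real a" "0 \<le> a"
    using conjugate_square_ge_0_vec[of w] by (metis nonnegative_complex_is_real of_real_Re less_eq_complex_def zero_complex.sel(1) complex_is_Real_iff)
  obtain c where c: "(M *\<^sub>v w) \<bullet>c w = complex_of_real c" "0 \<le> c"
    using psd[OF w] by (metis nonnegative_complex_is_real of_real_Re less_eq_complex_def zero_complex.sel(1) complex_is_Real_iff)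
  have Mwv: "(M *\<^sub>v w) \<bullet>c v = w \<bullet>c w"
    using cscalar_prod_mat_adjoint[OF Mc w v] by (simp add: adj w_def)
  have "0 \<le> e * (e * c - 2 * a)" for e :: real
  proof -
    let ?u = "v - complex_of_real e \<cdot>\<^sub>v w"
    have Mu: "M *\<^sub>v ?u = w - complex_of_real e \<cdot>\<^sub>v (M *\<^sub>v w)"
      using Mc v w by (simp add: mult_minus_distrib_mat_vec mult_mat_vec w_def)
    have cu: "conjugate ?u = conjugate v - complex_of_real e \<cdot>\<^sub>v conjugate w"
      using v w by (intro eq_vecI) auto
    have "(M *\<^sub>v ?u) \<bullet>c ?u = complex_of_real (e * (e * c - 2 * a))"
      unfolding Mu cu using v w Mw null a c Mwv
      by (simp add: minus_scalar_prod_distrib[of _ m] scalar_prod_minus_distrib[of _ m] algebra_simps flip: w_def)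
    then show ?thesis
      using psd[of ?u] v w by (simp add: less_eq_complex_def)
  qed
  \<comment> \<open>This e satisfies e c <= a, so the value is at most -e a; the summand 1 covers c
    = 0.\<close>
  from this[of "a / (c + 1)"] have "a = 0"
  proof -
    assume nonneg: "0 \<le> a / (c + 1) * (a / (c + 1) * c - 2 * a)"
    have "a / (c + 1) * c \<le> a"
      using a c by (simp add: field_simps)
    moreover have "0 < a / (c + 1)" if "a \<noteq> 0"
      using a c that by simp
    ultimately show ?thesis
      using nonneg a(2) by (smt (verit) mult_pos_neg)
  qed
  then show ?thesis
    using a w by (simp flip: w_def)
qed

text \<open>The columns of the product lie in the span of the at most \<open>k\<close> columns of
  \<open>A\<close>, so by the exchange lemma no independent set among them is larger.\<close>

lemma (in vec_space) rank_mult_le_inner_dim: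
  assumes A: "A \<in> carrier_mat n k" and B: "B \<in> carrier_mat k nc"
  shows "rank (A * B) \<le> k"
proof -
  obtain U where U: "maximal U (\<lambda>T. T \<subseteq> set (cols (A * B)) \<and> lin_indpt T)"
    using maximal_exists_superset[of "set (cols (A * B))" "\<lambda>T. T \<subseteq> set (cols (A * B)) \<and> lin_indpt T" "{}"]
      finite_lin_indpt2[of "{}"] by auto
  then have sub: "U \<subseteq> set (cols (A * B))" and indpt: "lin_indpt U"
    by (auto simp: maximal_def)
  have cA: "set (cols A) \<subseteq> carrier_vec n"
    using A cols_dim by blast
  have "set (cols (A * B)) \<subseteq> span (set (cols A))"
  proof
    fix u assume "u \<in> set (cols (A * B))"
    then obtain j where "j < nc" and uj: "u = cols (A * B) ! j"
      using B by (metis cols_length in_set_conv_nth carrier_matD(2) index_mult_mat(3))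
    then have "u = A *\<^sub>v col B j"
      using A B by (intro eq_vecI) auto
    with \<open>j < nc\<close> show "u \<in> span (set (cols A))"
      using col_space_eq[OF A] A B unfolding col_space_def by auto
  qed
  with sub have "U \<subseteq> span (set (cols A))" by blast
  then obtain C :: "'a vec set" where "int (card C) \<le> int (card (set (cols A))) - int (card U)"
    using replacement[OF finite_subset[OF sub] _ _ indpt, of "set (cols A)"] cA by auto
  then have "card U \<le> card (set (cols A))" by simp
  also have "\<dots> \<le> k"
    using card_length[of "cols A"] A by simp
  finally show ?thesis
    using rank_card_indpt[OF mult_carrier_mat[OF A B] U] by simp
qed

text \<open>More columns than the rank are dependent, and the coefficients of a dependency form the
  vector. Linear dependence is a notion for sets, in which equal columns merge; a repeated column is
  therefore treated apart, by a difference of two unit vectors.\<close>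

lemma (in vec_space) rank_less_card_kernel_vec:
  assumes A: "A \<in> carrier_mat n nc" and I: "I \<subseteq> {..<nc}" and rank: "rank A < card I"
  obtains v where "v \<in> carrier_vec nc" "v \<noteq> 0\<^sub>v nc" "\<And>i. i < nc \<Longrightarrow> i \<notin> I \<Longrightarrow> v $ i = 0"
    "A *\<^sub>v v = 0\<^sub>v n"
proof (cases "inj_on (col A) I")
  case True
  let ?U = "col A ` I"
  have fin: "finite I" using I finite_subset by blast
  have U: "?U \<subseteq> set (cols A)"
    using I A by (auto simp: cols_def)
  then have cU: "?U \<subseteq> carrier_vec n"
    using A cols_dim by blast
  have "lin_dep ?U"
    using rank_ge_card_indpt[OF A U] rank True by (auto simp: card_image)
  then obtain a w where a: "lincomb a ?U = 0\<^sub>v n" "w \<in> ?U" "a w \<noteq> 0"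
    using finite_lin_dep[of ?U] fin cU by auto
  define v where "v = vec nc (\<lambda>i. if i \<in> I then a (col A i) else 0)"
  obtain i where i: "i \<in> I" "w = col A i" using a by auto
  show ?thesis
  proof (rule that)
    show "v \<in> carrier_vec nc" by (simp add: v_def)
    show "v $ i = 0" if "i < nc" "i \<notin> I" for i using that by (simp add: v_def)
    show "v \<noteq> 0\<^sub>v nc"
    proof
      assume "v = 0\<^sub>v nc"
      then have "v $ i = 0" using i I by auto
      then show False using i I a by (auto simp: v_def)
    qed
    show "A *\<^sub>v v = 0\<^sub>v n"
    proof (rule eq_vecI)
      fix j assume "j < dim_vec (0\<^sub>v n :: 'a vec)"
      then have j: "j < n" by simp
      have "(A *\<^sub>v v) $ j = (\<Sum>i<nc. A $$ (j, i) * (if i \<in> I then a (col A i) else 0))"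
        using A j by (auto simp: v_def scalar_prod_def atLeast0LessThan intro!: sum.cong)
      also have "\<dots> = (\<Sum>i\<in>I. A $$ (j, i) * a (col A i))"
        using I by (intro sum.mono_neutral_cong_right) auto
      also have "\<dots> = (\<Sum>i\<in>I. a (col A i) * col A i $ j)"
        using A I j by (intro sum.cong) auto
      also have "\<dots> = (\<Sum>u\<in>?U. a u * u $ j)"
        by (simp add: sum.reindex[OF True])
      also have "\<dots> = 0"
        using lincomb_index[OF j cU, of a] a(1) j by simp
      finally show "(A *\<^sub>v v) $ j = 0\<^sub>v n $ j" using j by simp
    qed (use A in simp)
  qed
next
  case False
  then obtain i k where ik: "i \<in> I" "k \<in> I" "i \<noteq> k" "col A i = col A k"
    by (auto simp: inj_on_def)
  then have less: "i < nc" "k < nc" using I by auto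
  show ?thesis
  proof (rule that)
    let ?v = "unit_vec nc i - unit_vec nc k :: 'a vec"
    show "?v \<in> carrier_vec nc" by simp
    show "?v \<noteq> 0\<^sub>v nc"
    proof
      assume "?v = 0\<^sub>v nc"
      then have "?v $ i = 0\<^sub>v nc $ i" by (rule arg_cong[where f = "\<lambda>u. u $ i"])
      then show False using less ik by simp
    qed
    show "?v $ j = 0" if "j < nc" "j \<notin> I" for j using that ik less by auto
    have unit: "A *\<^sub>v unit_vec nc j = col A j" if "j < nc" for j
      using A that by (intro eq_vecI) auto
    show "A *\<^sub>v ?v = 0\<^sub>v n"
      unfolding mult_minus_distrib_mat_vec[OF A unit_vec_carrier unit_vec_carrier]
        unit[OF less(1)] unit[OF less(2)] ik(4)
      using A less by (intro eq_vecI) auto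
  qed
qed

lemma mult_adjoint_psd:
  assumes Z: "Z \<in> carrier_mat m K"
  shows "Z * mat_adjoint Z \<in> psd_mats_rank_le m K"
proof -
  have aZ: "mat_adjoint Z \<in> carrier_mat K m" using Z by auto
  have "mat_adjoint (Z * mat_adjoint Z) = Z * mat_adjoint Z"
  proof (rule eq_matI)
    fix i j assume "i < dim_row (Z * mat_adjoint Z)" "j < dim_col (Z * mat_adjoint Z)"
    then have "i < m" "j < m" using Z by auto
    then show "mat_adjoint (Z * mat_adjoint Z) $$ (i, j) = (Z * mat_adjoint Z) $$ (i, j)"
      using Z by (simp add: index_mult_adjoint[OF Z Z] mult_ac del: index_mult_mat(1))
  qed (use Z in auto)
  moreover have "0 \<le> (Z * mat_adjoint Z *\<^sub>v v) \<bullet>c v" if v: "v \<in> carrier_vec m" for v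
  proof -
    have u: "mat_adjoint Z *\<^sub>v v \<in> carrier_vec K" using aZ v by auto
    have "(Z * mat_adjoint Z *\<^sub>v v) \<bullet>c v = (mat_adjoint Z *\<^sub>v v) \<bullet>c (mat_adjoint Z *\<^sub>v v)"
      using cscalar_prod_mat_adjoint[OF Z u v] Z aZ v by (simp add: assoc_mult_mat_vec)
    then show ?thesis
      using conjugate_square_ge_0_vec by simp
  qed
  ultimately show ?thesis
    using vec_space.rank_mult_le_inner_dim[OF Z aZ] mult_carrier_mat[OF Z aZ]
    by (simp add: psd_mats_rank_le_def)
qed

subsection \<open>Sinusoids and Hankel-Toeplitz block matrices\<close>

lemma sinusoid_mat_carrier [simp]: "sinusoid_mat N K f \<in> carrier_mat N K"
  unfolding sinusoid_mat_def by (intro carrier_matI) simp_all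

lemma sinusoid_mat_index:
  assumes "j < N" "k < K"
  shows "sinusoid_mat N K f $$ (j, k) = cis (- (2 * pi * f k)) ^ j"
proof -
  have "cis (- (2 * pi * f k)) ^ j = cis (- (2 * pi * f k * real j))"
    by (subst DeMoivre) (simp add: mult.commute)
  then show ?thesis
    using assms by (simp add: sinusoid_mat_def mat_of_cols_index sinusoid_def cis_conv_exp)
qed

lemma index_sinusoid_mat_mult:
  assumes "S \<in> carrier_mat K L" "j < N" "l < L"
  shows "(sinusoid_mat N K f * S) $$ (j, l) = (\<Sum>k<K. cis (- (2 * pi * f k)) ^ j * S $$ (k, l))"
proof -
  have "dim_row (sinusoid_mat N K f) = N" "dim_col (sinusoid_mat N K f) = K"
    by (simp_all add: sinusoid_mat_def)
  then show ?thesis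
    using assms by (auto simp: scalar_prod_def atLeast0LessThan sinusoid_mat_index intro!: sum.cong)
qed

lemma unit_circle_frequency:
  assumes "cmod b = 1"
  obtains f where "f \<in> {0..<1}" "cis (- (2 * pi * f)) = b"
proof -
  \<comment> \<open>The sign matches the negative exponent in \<open>sinusoid\<close>. Passing to
    \<open>frac y\<close> changes the angle by a multiple of 2 pi.\<close>
  define y where "y = - Arg b / (2 * pi)"
  have "- (2 * pi * frac y) = Arg b + 2 * pi * of_int \<lfloor>y\<rfloor>"
    by (simp add: frac_def y_def field_simps)
  then have "cis (- (2 * pi * frac y)) = cis (Arg b)"
    by (simp flip: cis_mult)
  also have "\<dots> = b"
    using rcis_cmod_Arg[of b] assms by (simp add: rcis_def)
  finally show ?thesis
    using that[of "frac y"] by (simp add: frac_lt_1)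
qed

lemma toeplitz_carrier [simp]: "toeplitz n t \<in> carrier_mat n n"
  and hankel_carrier [simp]: "hankel n x \<in> carrier_mat n n"
  by (simp_all add: toeplitz_def hankel_def)

lemma toeplitz_index [simp]: "i < n \<Longrightarrow> j < n \<Longrightarrow> toeplitz n t $$ (i, j) = t $ (n + i - j - 1)"
  and hankel_index [simp]: "i < n \<Longrightarrow> j < n \<Longrightarrow> hankel n x $$ (i, j) = x $ (i + j)"
  by (simp_all add: toeplitz_def hankel_def)

text \<open>One channel of \<open>S_HT\<close>, with \<open>s\<close> for
  \<open>conjugate (ts l)\<close> and \<open>x\<close> for \<open>col X l\<close>; the conjugation
  is moved from the matrix to its column.\<close>

definition ht_mat :: "nat \<Rightarrow> complex vec \<Rightarrow> complex vec \<Rightarrow> complex vec \<Rightarrow> complex mat" where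
  "ht_mat n s x t = four_block_mat (toeplitz n s) (hankel n (conjugate x)) (hankel n x) (toeplitz n t)"

lemma ht_mat_carrier: "ht_mat n s x t \<in> carrier_mat (2 * n) (2 * n)"
  unfolding ht_mat_def mult_2 by (intro four_block_carrier_mat toeplitz_carrier)

text \<open>On such vectors the quadratic form of the block matrix sees only
  \<open>toeplitz n t\<close>, the block shared by all channels.\<close>

definition lower_coeffs :: "nat \<Rightarrow> complex poly \<Rightarrow> complex vec" where
  "lower_coeffs n p = 0\<^sub>v n @\<^sub>v vec n (coeff p)"

lemma lower_coeffs_carrier: "lower_coeffs n p \<in> carrier_vec (2 * n)"
  unfolding lower_coeffs_def mult_2 by (intro append_carrier_vec) simp_all

abbreviation toeplitz_form :: "nat \<Rightarrow> complex vec \<Rightarrow> complex poly \<Rightarrow> complex poly \<Rightarrow> complex" where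
  "toeplitz_form n t \<equiv> poly_form n (\<lambda>j k. t $ (n + j - k - 1))"

lemma toeplitz_mult_carrier [simp]: "v \<in> carrier_vec n \<Longrightarrow> toeplitz n t *\<^sub>v v \<in> carrier_vec n"
  and hankel_mult_carrier [simp]: "v \<in> carrier_vec n \<Longrightarrow> hankel n x *\<^sub>v v \<in> carrier_vec n"
  by (rule mult_mat_vec_carrier[of _ n n]; simp)+

lemma ht_mat_mult_lower_coeffs:
  "ht_mat n s x t *\<^sub>v lower_coeffs n p =
     hankel n (conjugate x) *\<^sub>v vec n (coeff p) @\<^sub>v toeplitz n t *\<^sub>v vec n (coeff p)"
proof -
  have "toeplitz n s *\<^sub>v 0\<^sub>v n = 0\<^sub>v n" "hankel n x *\<^sub>v 0\<^sub>v n = 0\<^sub>v n"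
    by (intro eq_vecI; simp add: toeplitz_def hankel_def scalar_prod_def)+
  then show ?thesis
    unfolding ht_mat_def lower_coeffs_def
    by (subst four_block_mat_mult_vec[of _ n n _ n _ n]) auto
qed

lemma ht_mat_quadratic_form:
  "(ht_mat n s x t *\<^sub>v lower_coeffs n p) \<bullet>c lower_coeffs n q = toeplitz_form n t p q"
proof -
  have conj: "conjugate (lower_coeffs n q) = 0\<^sub>v n @\<^sub>v conjugate (vec n (coeff q))"
    by (intro eq_vecI) (auto simp: lower_coeffs_def)
  have "(ht_mat n s x t *\<^sub>v lower_coeffs n p) \<bullet>c lower_coeffs n q
      = (toeplitz n t *\<^sub>v vec n (coeff p)) \<bullet>c vec n (coeff q)"
    unfolding ht_mat_mult_lower_coeffs conj
    by (subst scalar_prod_append[of _ n _ n]) simp_all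
  also have "\<dots> = toeplitz_form n t p q"
    by (auto simp: poly_form_def scalar_prod_def atLeast0LessThan toeplitz_def sum_distrib_left
        sum_distrib_right mult_ac intro!: sum.cong)
  finally show ?thesis .
qed

text \<open>By \<open>psd_null_vector\<close> the padded \<open>p\<close> lies in the kernel. The
  lower half of the product gives the Toeplitz equations, the upper half a linear relation for each
  window of the conjugated samples.\<close>

lemma ht_mat_null_poly:
  assumes M: "ht_mat n s x t \<in> psd_mats_rank_le (2 * n) K"
    and null: "toeplitz_form n t p p = 0" and x: "x \<in> carrier_vec (2 * n - 1)" and j: "j < n"
  shows "(\<Sum>k<n. t $ (n + j - k - 1) * coeff p k) = 0"
    and "(\<Sum>k<n. cnj (x $ (j + k)) * coeff p k) = 0"
proof -
  let ?v = "vec n (coeff p)"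
  have eq: "hankel n (conjugate x) *\<^sub>v ?v @\<^sub>v toeplitz n t *\<^sub>v ?v = 0\<^sub>v (2 * n)"
    using psd_null_vector[OF M lower_coeffs_carrier, unfolded ht_mat_quadratic_form, OF null]
    by (simp add: ht_mat_mult_lower_coeffs)
  have "(toeplitz n t *\<^sub>v ?v) $ j = (hankel n (conjugate x) *\<^sub>v ?v @\<^sub>v toeplitz n t *\<^sub>v ?v) $ (n + j)"
    using j by (simp add: toeplitz_def hankel_def)
  then have "(toeplitz n t *\<^sub>v ?v) $ j = 0"
    unfolding eq using j by simp
  then show "(\<Sum>k<n. t $ (n + j - k - 1) * coeff p k) = 0"
    using j by (simp add: toeplitz_def scalar_prod_def atLeast0LessThan)
  have "(hankel n (conjugate x) *\<^sub>v ?v) $ j = (hankel n (conjugate x) *\<^sub>v ?v @\<^sub>v toeplitz n t *\<^sub>v ?v) $ j"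
    using j by (simp add: toeplitz_def hankel_def)
  then have "(hankel n (conjugate x) *\<^sub>v ?v) $ j = 0"
    unfolding eq using j by simp
  then show "(\<Sum>k<n. cnj (x $ (j + k)) * coeff p k) = 0"
    using j x by (simp add: hankel_def scalar_prod_def atLeast0LessThan)
qed

lemma ht_mat_hermitian:
  assumes M: "ht_mat n s x t \<in> psd_mats_rank_le (2 * n) K" and "j < n" "k < n"
  shows "t $ (n + j - k - 1) = cnj (t $ (n + k - j - 1))"
proof -
  let ?M = "ht_mat n s x t"
  have entry: "?M $$ (n + a, n + b) = t $ (n + a - b - 1)" if "a < n" "b < n" for a b
    using that by (simp add: ht_mat_def toeplitz_def)
  have "mat_adjoint ?M = ?M"
    using M by (simp add: psd_mats_rank_le_def)
  then have "?M $$ (n + j, n + k) = mat_adjoint ?M $$ (n + j, n + k)" by simp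
  also have "\<dots> = cnj (?M $$ (n + k, n + j))"
    using assms ht_mat_carrier[of n s x t] by simp
  finally show ?thesis
    using assms by (simp add: entry)
qed

text \<open>The \<open>K + 1\<close> columns from \<open>n\<close> to \<open>n + K\<close> outnumber
  the rank, and \<open>K < n\<close> keeps them inside the right half. A kernel vector supported
  there is a padded polynomial of degree at most \<open>K\<close>.\<close>

lemma ht_mat_low_degree_null_poly:
  assumes M: "ht_mat n s x t \<in> psd_mats_rank_le (2 * n) K" and "K < n"
  shows "\<exists>p. p \<noteq> 0 \<and> degree p \<le> K \<and> toeplitz_form n t p p = 0"
proof -
  have sub: "{n..n + K} \<subseteq> {..<2 * n}" using \<open>K < n\<close> by auto
  have rank: "vec_space.rank (2 * n) (ht_mat n s x t) < card {n..n + K}"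
    using M by (simp add: psd_mats_rank_le_def)
  obtain v where v: "v \<in> carrier_vec (2 * n)" "v \<noteq> 0\<^sub>v (2 * n)"
    and supp: "\<And>i. i < 2 * n \<Longrightarrow> i \<notin> {n..n + K} \<Longrightarrow> v $ i = 0"
    and Mv: "ht_mat n s x t *\<^sub>v v = 0\<^sub>v (2 * n)"
    by (rule vec_space.rank_less_card_kernel_vec[OF ht_mat_carrier sub rank]) blast
  define p where "p = Poly (map (\<lambda>k. v $ (n + k)) [0..<Suc K])"
  have coeff: "coeff p k = (if k \<le> K then v $ (n + k) else 0)" for k
    by (auto simp: p_def nth_default_def simp del: upt_Suc)
  have vp: "lower_coeffs n p = v"
  proof (rule eq_vecI)
    fix i assume "i < dim_vec v"
    then have "i < 2 * n" using v by simp
    then show "lower_coeffs n p $ i = v $ i"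
      using supp[of i] by (auto simp: lower_coeffs_def coeff)
  qed (use v lower_coeffs_carrier[of n p] in simp)
  have "p \<noteq> 0"
  proof
    assume "p = 0"
    then have "v = 0\<^sub>v (2 * n)"
      unfolding vp[symmetric] by (intro eq_vecI) (auto simp: lower_coeffs_def)
    then show False using v by simp
  qed
  moreover have "degree p \<le> K"
    by (rule degree_le) (simp add: coeff)
  moreover have "toeplitz_form n t p p = 0"
    unfolding ht_mat_quadratic_form[of n s x t p p, symmetric] vp Mv using v by simp
  ultimately show ?thesis by blast
qed

text \<open>Iterates \<open>poly_form_shift\<close>: shifts of an isotropic polynomial stay
  isotropic while their degree is below \<open>n\<close>.\<close>

lemma toeplitz_form_monom_mult:
  assumes "s + degree g < n"
  shows "toeplitz_form n t (monom 1 s * g) (monom 1 s * g) = toeplitz_form n t g g"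
  using assms
proof (induction s)
  case (Suc s)
  have "degree (monom 1 s * g) \<le> s + degree g"
    using degree_mult_le[of "monom 1 s" g] degree_monom_le[of "1::complex" s] by linarith
  then show ?case
    using poly_form_shift[of n "\<lambda>j k. t $ (n + j - k - 1)" "monom 1 s * g" "monom 1 s * g"] Suc
    by (simp add: monom_Suc)
qed simp

section \<open>The three inclusions\<close>

lemma S_0_subset_S_MF:
  assumes "0 < n" "0 < L"
  shows "S_0 n K L \<subseteq> S_MF n K L"
proof
  fix X assume "X \<in> S_0 n K L"
  then obtain f S where X: "X = sinusoid_mat (2 * n - 1) K f * S" and S: "S \<in> carrier_mat K L"
    by (auto simp: S_0_def)
  define z where "z k = cis (- (2 * pi * f k))" for k
  have z: "z k * cnj (z k) = 1" for k
    by (simp add: z_def cis_mult cis_cnj)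
  text \<open>The power \<open>p k = b k\<^sup>2\<close> of the \<open>k\<close>-th sinusoid is forced: the Toeplitz weights \<open>q\<close> of channel \<open>l\<close>
    must satisfy \<open>p k * q k l = \<bar>S k l\<bar>\<^sup>2\<close> and average to \<open>p k\<close> over the channels.\<close>
  define p where "p k = sqrt ((\<Sum>l<L. (cmod (S $$ (k, l)))\<^sup>2) / L)" for k
  define b where "b k = complex_of_real (sqrt (p k))" for k
  \<comment> \<open>If \<open>p k = 0\<close>, row \<open>k\<close> of \<open>S\<close> vanishes, so
    the default 0 still gives \<open>b k * w k l = S $$ (k, l)\<close>.\<close>
  define w where "w k l = (if p k = 0 then 0 else S $$ (k, l) / b k)" for k l
  define Z1 where "Z1 l = mat n K (\<lambda>(j, k). cnj (z k ^ j * w k l))" for l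
  define Z2 where "Z2 = mat n K (\<lambda>(j, k). z k ^ j * b k)"
  \<comment> \<open>Index \<open>n - 1\<close> is the main diagonal. As \<open>z k\<close> is
    unimodular, the factor \<open>cnj (z k) ^ (n - 1)\<close> turns index
    \<open>n + i - j - 1\<close> into \<open>z k ^ i * cnj (z k) ^ j\<close>.\<close>
  define ts where "ts l = vec (2 * n - 1) (\<lambda>m. \<Sum>k<K. w k l * cnj (w k l) * (z k ^ m * cnj (z k) ^ (n - 1)))" for l
  have p_nonneg: "p k \<ge> 0" for k
    by (simp add: p_def sum_nonneg)
  have bb: "b k * b k = complex_of_real (p k)" for k
    using p_nonneg[of k] by (simp add: b_def flip: of_real_mult)
  have b0: "b k = 0 \<longleftrightarrow> p k = 0" for k
    by (simp add: b_def)
  have bw: "b k * w k l = S $$ (k, l)" if "l < L" for k l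
  proof (cases "p k = 0")
    case True
    then have "(\<Sum>l<L. (cmod (S $$ (k, l)))\<^sup>2) = 0"
      using \<open>0 < L\<close> by (simp add: p_def)
    then have "\<forall>l\<in>{..<L}. (cmod (S $$ (k, l)))\<^sup>2 = 0"
      by (subst (asm) sum_nonneg_eq_0_iff) auto
    then show ?thesis
      using that True by (simp add: w_def)
  next
    case False
    then show ?thesis by (simp add: w_def b0)
  qed
  have weights: "(\<Sum>l<L. w k l * cnj (w k l)) = of_nat L * (b k * b k)" for k
  proof (cases "p k = 0")
    case True
    then show ?thesis by (simp add: w_def b_def)
  next
    case False
    \<comment> \<open>Multiplied by \<open>b k * b k\<close>, the sum becomes the energy of row
      \<open>k\<close> of \<open>S\<close>, which is \<open>L * (p k * p k)\<close> by the choice of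
      \<open>p\<close>; the nonzero factor is then cancelled.\<close>
    have "(\<Sum>l<L. w k l * cnj (w k l)) * (b k * b k) = (\<Sum>l<L. (b k * w k l) * cnj (b k * w k l))"
      unfolding sum_distrib_right by (intro sum.cong) (simp_all add: b_def mult_ac)
    also have "\<dots> = complex_of_real (\<Sum>l<L. (cmod (S $$ (k, l)))\<^sup>2)"
      by (simp add: bw complex_norm_square del: of_real_power)
    also have "(\<Sum>l<L. (cmod (S $$ (k, l)))\<^sup>2) = L * (p k * p k)"
      using \<open>0 < L\<close> by (simp add: p_def sum_nonneg flip: power2_eq_square)
    also have "complex_of_real \<dots> = of_nat L * (b k * b k) * (b k * b k)"
      by (simp add: bb)
    finally show ?thesis
      using False by (simp add: b0)
  qed
  have shift: "z k ^ (n + i - j - 1) * cnj (z k) ^ (n - 1) = z k ^ i * cnj (z k) ^ j"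
    if "i < n" "j < n" for i j k
  proof -
    have e: "n + i - j - 1 = i + (n - 1 - j)" "n - 1 = (n - 1 - j) + j"
      using that by auto
    have "z k ^ (n + i - j - 1) * cnj (z k) ^ (n - 1)
        = z k ^ i * cnj (z k) ^ j * (z k * cnj (z k)) ^ (n - 1 - j)"
      by (subst e(1), subst e(2)) (simp add: power_add power_mult_distrib mult_ac)
    then show ?thesis by (simp add: z)
  qed
  have ts_dim: "dim_vec (ts l) = 2 * n - 1" for l
    by (simp add: ts_def)
  have ts_entry: "ts l $ (n + i - j - 1) = (\<Sum>k<K. w k l * cnj (w k l) * (z k ^ i * cnj (z k) ^ j))"
    if "i < n" "j < n" for i j l
  proof -
    have "n + i - j - 1 < 2 * n - 1" using that by auto
    then show ?thesis
      by (simp only: ts_def index_vec shift[OF that])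
  qed
  have Xc: "X \<in> carrier_mat (2 * n - 1) L"
    unfolding X using S by (intro mult_carrier_mat) auto
  have Z1: "Z1 l \<in> carrier_mat n K" and Z2: "Z2 \<in> carrier_mat n K" for l
    by (simp_all add: Z1_def Z2_def)
  have "hankel n (col X l) = Z2 * mat_adjoint (Z1 l)" if l: "l < L" for l
  proof (rule eq_matI)
    fix i j assume "i < dim_row (Z2 * mat_adjoint (Z1 l))" "j < dim_col (Z2 * mat_adjoint (Z1 l))"
    then have ij: "i < n" "j < n" by (simp_all add: Z1_def Z2_def)
    have "hankel n (col X l) $$ (i, j) = X $$ (i + j, l)"
      using ij l Xc by simp
    also have "\<dots> = (\<Sum>k<K. z k ^ (i + j) * S $$ (k, l))"
      unfolding X z_def by (rule index_sinusoid_mat_mult[OF S _ l]) (use ij in simp)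
    also have "\<dots> = (Z2 * mat_adjoint (Z1 l)) $$ (i, j)"
      unfolding index_mult_adjoint[OF Z2 Z1 ij]
      using ij by (intro sum.cong) (simp_all add: Z1_def Z2_def power_add bw[OF l, symmetric])
    finally show "hankel n (col X l) $$ (i, j) = (Z2 * mat_adjoint (Z1 l)) $$ (i, j)" .
  qed (simp_all add: Z1_def Z2_def hankel_def)
  moreover have "toeplitz n (conjugate (ts l)) = Z1 l * mat_adjoint (Z1 l)" for l
  proof (rule eq_matI)
    fix i j assume "i < dim_row (Z1 l * mat_adjoint (Z1 l))" "j < dim_col (Z1 l * mat_adjoint (Z1 l))"
    then have ij: "i < n" "j < n" by (simp_all add: Z1_def)
    have "toeplitz n (conjugate (ts l)) $$ (i, j) = cnj (ts l $ (n + i - j - 1))"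
      using ij by (simp add: ts_dim)
    also have "\<dots> = (Z1 l * mat_adjoint (Z1 l)) $$ (i, j)"
      unfolding index_mult_adjoint[OF Z1 Z1 ij] ts_entry[OF ij] cnj_sum
      using ij by (intro sum.cong) (simp_all add: Z1_def mult_ac)
    finally show "toeplitz n (conjugate (ts l)) $$ (i, j) = (Z1 l * mat_adjoint (Z1 l)) $$ (i, j)" .
  qed (simp_all add: Z1_def toeplitz_def)
  moreover have "(1 / of_nat L) \<cdot>\<^sub>m mat n n (\<lambda>(j, k). \<Sum>q<L. toeplitz n (ts q) $$ (j, k)) = Z2 * mat_adjoint Z2"
  proof (rule eq_matI)
    fix i j assume "i < dim_row (Z2 * mat_adjoint Z2)" "j < dim_col (Z2 * mat_adjoint Z2)"
    then have ij: "i < n" "j < n" by (simp_all add: Z2_def)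
    have "(\<Sum>q<L. toeplitz n (ts q) $$ (i, j))
        = (\<Sum>q<L. \<Sum>k<K. w k q * cnj (w k q) * (z k ^ i * cnj (z k) ^ j))"
      by (simp only: toeplitz_index[OF ij] ts_entry[OF ij])
    also have "\<dots> = (\<Sum>k<K. \<Sum>q<L. w k q * cnj (w k q) * (z k ^ i * cnj (z k) ^ j))"
      by (rule sum.swap)
    also have "\<dots> = of_nat L * (\<Sum>k<K. b k * b k * (z k ^ i * cnj (z k) ^ j))"
      unfolding sum_distrib_right[symmetric] weights sum_distrib_left by (simp add: mult.assoc)
    also have "(\<Sum>k<K. b k * b k * (z k ^ i * cnj (z k) ^ j)) = (Z2 * mat_adjoint Z2) $$ (i, j)"
      unfolding index_mult_adjoint[OF Z2 Z2 ij]
      using ij by (intro sum.cong) (simp_all add: Z2_def b_def mult_ac)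
    finally show "((1 / of_nat L) \<cdot>\<^sub>m mat n n (\<lambda>(j, k). \<Sum>q<L. toeplitz n (ts q) $$ (j, k))) $$ (i, j)
        = (Z2 * mat_adjoint Z2) $$ (i, j)"
      using ij \<open>0 < L\<close> by (simp del: toeplitz_index index_mult_mat(1))
  qed (simp_all add: Z2_def)
  ultimately show "X \<in> S_MF n K L"
    unfolding S_MF_def using Xc Z1 Z2
    by (intro CollectI conjI exI[of _ ts] exI[of _ Z1] exI[of _ "\<lambda>_. Z2"] allI impI)
      (simp_all add: ts_def del: toeplitz_index)
qed

lemma S_MF_subset_S_HT:
  assumes "0 < n" "0 < L"
  shows "S_MF n K L \<subseteq> S_HT n K L"
proof
  fix X assume "X \<in> S_MF n K L"
  then obtain ts Z1 Z2 where X: "X \<in> carrier_mat (2 * n - 1) L"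
    and ts: "\<And>l. l < L \<Longrightarrow> ts l \<in> carrier_vec (2 * n - 1)"
    and Z1: "\<And>l. l < L \<Longrightarrow> Z1 l \<in> carrier_mat n K" and Z2: "\<And>l. l < L \<Longrightarrow> Z2 l \<in> carrier_mat n K"
    and H: "\<And>l. l < L \<Longrightarrow> hankel n (col X l) = Z2 l * mat_adjoint (Z1 l)"
    and T1: "\<And>l. l < L \<Longrightarrow> toeplitz n (conjugate (ts l)) = Z1 l * mat_adjoint (Z1 l)"
    and T2: "\<And>l. l < L \<Longrightarrow> (1 / of_nat L) \<cdot>\<^sub>m mat n n (\<lambda>(j, k). \<Sum>q<L. toeplitz n (ts q) $$ (j, k))
      = Z2 l * mat_adjoint (Z2 l)"
    unfolding S_MF_def by blast
  \<comment> \<open>The average meets the sum condition, and by linearity its Toeplitz matrix is the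
    left side of \<open>T2\<close>.\<close>
  define t where "t = vec (2 * n - 1) (\<lambda>i. (\<Sum>q<L. ts q $ i) / of_nat L)"
  have T: "toeplitz n t = Z2 l * mat_adjoint (Z2 l)" if "l < L" for l
    unfolding T2[OF that, symmetric] by (intro eq_matI) (auto simp: t_def toeplitz_def)
  have "finsum_vec TYPE(complex) (2 * n - 1) ts {..<L} = of_nat L \<cdot>\<^sub>v t"
  proof (rule eq_vecI)
    fix i assume "i < dim_vec (of_nat L \<cdot>\<^sub>v t)"
    then show "finsum_vec TYPE(complex) (2 * n - 1) ts {..<L} $ i = (of_nat L \<cdot>\<^sub>v t) $ i"
      using ts \<open>0 < L\<close> by (subst index_finsum_vec) (auto simp: t_def)
  next
    have "finsum_vec TYPE(complex) (2 * n - 1) ts {..<L} \<in> carrier_vec (2 * n - 1)"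
      using ts by (intro finsum_vec_closed) auto
    then show "dim_vec (finsum_vec TYPE(complex) (2 * n - 1) ts {..<L}) = dim_vec (of_nat L \<cdot>\<^sub>v t)"
      by (simp add: t_def)
  qed
  moreover have "four_block_mat (toeplitz n (conjugate (ts l))) (hankel n (col (map_mat cnj X) l))
        (hankel n (col X l)) (toeplitz n t) \<in> psd_mats_rank_le (2 * n) K" (is "?M \<in> _") if l: "l < L" for l
  proof -
    define Z where "Z = mat (2 * n) K (\<lambda>(i, k). if i < n then Z1 l $$ (i, k) else Z2 l $$ (i - n, k))"
    have Z: "Z \<in> carrier_mat (2 * n) K" by (simp add: Z_def)
    note prods = index_mult_adjoint[OF Z1[OF l] Z1[OF l], folded T1[OF l]]
      index_mult_adjoint[OF Z2[OF l] Z1[OF l], folded H[OF l]]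
      index_mult_adjoint[OF Z2[OF l] Z2[OF l], folded T[OF l]]
    \<comment> \<open>Hankel matrices are symmetric, so conjugating the samples gives the adjoint of
      the lower left block.\<close>
    have H': "hankel n (col (map_mat cnj X) l) $$ (i, j) = (\<Sum>h<K. Z1 l $$ (i, h) * cnj (Z2 l $$ (j, h)))"
      if "i < n" "j < n" for i j
    proof -
      have "hankel n (col (map_mat cnj X) l) $$ (i, j) = cnj (hankel n (col X l) $$ (j, i))"
        using X l that by (simp add: add.commute)
      then show ?thesis
        using that by (simp add: prods mult.commute del: hankel_index)
    qed
    have "?M = Z * mat_adjoint Z"
    proof (rule eq_matI)
      fix i j assume "i < dim_row (Z * mat_adjoint Z)" "j < dim_col (Z * mat_adjoint Z)"
      then have ij: "i < 2 * n" "j < 2 * n" using Z by auto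
      have dims: "dim_row (toeplitz n u) = n" "dim_col (toeplitz n u) = n" for u
        by (simp_all add: toeplitz_def)
      show "?M $$ (i, j) = (Z * mat_adjoint Z) $$ (i, j)"
        unfolding index_mult_adjoint[OF Z Z ij] using ij
        by (cases "i < n"; cases "j < n")
          (simp_all add: dims prods H' Z_def del: toeplitz_index hankel_index)
    qed (simp_all add: Z_def toeplitz_def)
    then show ?thesis
      using mult_adjoint_psd[OF Z] by simp
  qed
  moreover have "t \<in> carrier_vec (2 * n - 1)" by (simp add: t_def)
  ultimately show "X \<in> S_HT n K L"
    unfolding S_HT_def using X ts by blast
qed

lemma S_HT_subset_S_0:
  assumes "0 < n" "0 < L" "K < n"
  shows "S_HT n K L \<subseteq> S_0 n K L"
proof
  fix X assume "X \<in> S_HT n K L"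
  then obtain ts t where X: "X \<in> carrier_mat (2 * n - 1) L"
    and block: "\<And>l. l < L \<Longrightarrow> four_block_mat (toeplitz n (conjugate (ts l))) (hankel n (col (map_mat cnj X) l))
        (hankel n (col X l)) (toeplitz n t) \<in> psd_mats_rank_le (2 * n) K"
    unfolding S_HT_def by blast
  have M: "ht_mat n (conjugate (ts l)) (col X l) t \<in> psd_mats_rank_le (2 * n) K" if "l < L" for l
  proof -
    have "col (map_mat cnj X) l = conjugate (col X l)"
      using X that by (intro eq_vecI) auto
    then show ?thesis
      using block[OF that] by (simp add: ht_mat_def)
  qed
  \<comment> \<open>The Toeplitz form depends on \<open>t\<close> alone, so one channel suffices to
    find \<open>g\<close> and study its roots.\<close>
  note M0 = M[OF \<open>0 < L\<close>]
  let ?null = "\<lambda>p. p \<noteq> 0 \<and> toeplitz_form n t p p = 0"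
  obtain p where p: "?null p" "degree p \<le> K"
    using ht_mat_low_degree_null_poly[OF M0 \<open>K < n\<close>] by blast
  obtain g where g: "g \<noteq> 0" "toeplitz_form n t g g = 0"
    and least: "\<And>p. ?null p \<Longrightarrow> degree g \<le> degree p"
    using ex_has_least_nat[of ?null p degree, OF p(1)] by blast
  have dg: "degree g \<le> K"
    using least[OF p(1)] p(2) by simp
  have colX: "col X l \<in> carrier_vec (2 * n - 1)" for l
    using X by (metis carrier_matD(1) col_dim)
  have null: "toeplitz_form n t g q = 0" for q
  proof -
    have "toeplitz_form n t g q
        = (\<Sum>j<n. cnj (coeff q j) * (\<Sum>k<n. t $ (n + j - k - 1) * coeff g k))"
      by (simp add: poly_form_def sum_distrib_left mult.assoc)
    then show ?thesis
      using ht_mat_null_poly(1)[OF M0 g(2) colX] by simp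
  qed
  have minimal: "toeplitz_form n t h h \<noteq> 0" if "h \<noteq> 0" "degree h < degree g" for h
    using least[of h] that by auto
  have unit: "cmod a = 1" if "poly g a = 0" for a
    by (intro minimal_null_poly_roots(1)[of n "\<lambda>j k. t $ (n + j - k - 1)" g]
        ht_mat_hermitian[OF M0] null g(1) minimal; use that dg \<open>K < n\<close> in simp)
  have simple: "\<not> [:- a, 1:]\<^sup>2 dvd g" for a
    by (intro minimal_null_poly_roots(2)[of n "\<lambda>j k. t $ (n + j - k - 1)" g]
        ht_mat_hermitian[OF M0] null g(1) minimal; use dg \<open>K < n\<close> in simp)
  have "\<exists>c. \<forall>i<2 * n - 1. cnj (col X l $ i) = (\<Sum>a | poly g a = 0. c a * a ^ i)" if l: "l < L" for l
  proof (rule linear_recurrence_simple_roots[OF g(1) simple])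
    fix m assume m: "m + degree g < 2 * n - 1"
    text \<open>Every window of the recurrence is a row of the Hankel matrix applied to a shift of \<open>g\<close>.\<close>
    define s where "s = min m (n - 1 - degree g)"
    define j where "j = m - s"
    \<comment> \<open>Since \<open>m\<close> is at most \<open>2 * n - 2 - degree g\<close>, a shift
      capped at \<open>n - 1 - degree g\<close> leaves a row index of at most
      \<open>n - 1\<close>.\<close>
    have s: "s + degree g < n" and j: "j < n" and msj: "m = j + s"
      using m dg \<open>K < n\<close> by (auto simp: s_def j_def)
    have "0 = (\<Sum>k<n. cnj (col X l $ (j + k)) * coeff (monom 1 s * g) k)"
      using ht_mat_null_poly(2)[OF M[OF l] _ colX j, of "monom 1 s * g"] toeplitz_form_monom_mult[OF s] g(2)
      by simp
    also have "\<dots> = (\<Sum>k\<in>{s..s + degree g}. cnj (col X l $ (j + k)) * coeff g (k - s))"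
      using s by (intro sum.mono_neutral_cong_right) (auto simp: coeff_monom_mult coeff_eq_0)
    also have "\<dots> = (\<Sum>i\<le>degree g. coeff g i * cnj (col X l $ (i + m)))"
      by (rule sum.reindex_bij_witness[of _ "\<lambda>i. i + s" "\<lambda>k. k - s"]) (auto simp: msj ac_simps)
    finally show "(\<Sum>i\<le>degree g. coeff g i * cnj (col X l $ (i + m))) = 0" by simp
  qed
  then obtain c where c: "\<And>l i. l < L \<Longrightarrow> i < 2 * n - 1 \<Longrightarrow>
      cnj (col X l $ i) = (\<Sum>a | poly g a = 0. c l a * a ^ i)"
    by metis
  let ?R = "{a. poly g a = 0}"
  have finR: "finite ?R" using poly_roots_finite g by blast
  have cardR: "card ?R \<le> K" using card_poly_roots_bound[OF g(1)] dg by simp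
  obtain e where e: "bij_betw e {..<card ?R} ?R"
    using ex_bij_betw_nat_finite[OF finR] by (auto simp: atLeast0LessThan)
  \<comment> \<open>The recurrence holds for conjugated samples, so the sinusoids of
    \<open>X\<close> belong to the conjugates of the roots.\<close>
  have "\<exists>\<phi>. \<phi> \<in> {0..<1} \<and> cis (- (2 * pi * \<phi>)) = cnj a" if "a \<in> ?R" for a
    using unit_circle_frequency[of "cnj a"] unit[of a] that by auto
  then obtain F where F: "\<And>a. a \<in> ?R \<Longrightarrow> F a \<in> {0..<1} \<and> cis (- (2 * pi * F a)) = cnj a"
    by metis
  \<comment> \<open>There may be fewer than \<open>K\<close> roots; the remaining columns get
    frequency 0 and amplitude 0.\<close>
  define f where "f k = (if k < card ?R then F (e k) else 0)" for k
  define S where "S = mat K L (\<lambda>(k, l). if k < card ?R then cnj (c l (e k)) else 0)"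
  have S: "S \<in> carrier_mat K L" by (simp add: S_def)
  have eR: "e k \<in> ?R" if "k < card ?R" for k
    using e that by (auto simp: bij_betw_def)
  have "X = sinusoid_mat (2 * n - 1) K f * S"
  proof (rule eq_matI)
    fix i l assume "i < dim_row (sinusoid_mat (2 * n - 1) K f * S)" "l < dim_col (sinusoid_mat (2 * n - 1) K f * S)"
    then have il: "i < 2 * n - 1" "l < L"
      using S by (simp_all add: sinusoid_mat_def)
    have "(sinusoid_mat (2 * n - 1) K f * S) $$ (i, l) = (\<Sum>k<K. cis (- (2 * pi * f k)) ^ i * S $$ (k, l))"
      using index_sinusoid_mat_mult[OF S il] .
    also have "\<dots> = (\<Sum>k<card ?R. cnj (c l (e k)) * cnj (e k) ^ i)"
      using cardR il F eR by (intro sum.mono_neutral_cong_right) (auto simp: S_def f_def mult.commute)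
    also have "\<dots> = (\<Sum>a\<in>?R. cnj (c l a) * cnj a ^ i)"
      by (rule sum.reindex_bij_betw[OF e])
    also have "\<dots> = cnj (cnj (col X l $ i))"
      unfolding c[OF il(2,1)] by simp
    also have "\<dots> = X $$ (i, l)"
      using X il by simp
    finally show "X $$ (i, l) = (sinusoid_mat (2 * n - 1) K f * S) $$ (i, l)" by simp
  qed (use X S in \<open>simp_all add: sinusoid_mat_def\<close>)
  moreover have "f k \<in> {0..<1}" for k
    using F eR by (simp add: f_def)
  ultimately show "X \<in> S_0 n K L"
    unfolding S_0_def using S by blast
qed

theorem theorem1:
  fixes n K L :: nat
  assumes "0 < n" and "0 < K" and "0 < L"
    and "K < n"
  shows "S_MF n K L = S_HT n K L \<and> S_HT n K L = S_0 n K L"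
proof -
  have "S_0 n K L \<subseteq> S_MF n K L" "S_MF n K L \<subseteq> S_HT n K L" "S_HT n K L \<subseteq> S_0 n K L"
    using assms by (simp_all add: S_0_subset_S_MF S_MF_subset_S_HT S_HT_subset_S_0)
  then show ?thesis by auto
qed

end
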